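(* Let $n$ be even, $1\le d\le n$, $\delta\in[0,1]$, $\rho=1-2\delta$, let $\theta_*\in\mathbb{R}^d$ with $0<\|\theta_*\|\le1$ and $\theta_\sharp=\pm\theta_*$. Let $U_i=\|\theta_*\|\cdot S_i+W_i$ for $1\le i\le n$, where $W_i\sim N(0,1)$ are i.i.d. and independent of the sign chain $S_0^n$ with flip probability $\delta$. Set $$\hat\rho=\frac{1}{\|\theta_\sharp\|^2}\cdot\frac2n\sum_{i=1}^{n/2}U_{2i}U_{2i-1},\qquad\hat\delta=\tfrac12(1-\hat\rho).$$ Then, with probability at least $1-\frac8n$, $$|\hat\delta-\delta|=\tfrac12|\hat\rho-\rho|\le\frac{18\log(n)}{\|\theta_*\|^2}\sqrt{\frac1n}.$$
   Context: $S_0,S_1,\dots,S_n\in\{-1,1\}$ is a Markov chain with $\mathbb{P}[S_0=1]=\frac12$ and, for $i\ge1$, $S_i=S_{i-1}$ with probability $1-\delta$ and $S_i=-S_{i-1}$ with probability $\delta$. $\|\cdot\|$ is the Euclidean norm and $\log$ is the natural logarithm. *)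

theory Defs
  imports "HOL-Probability.Probability"
begin

text \<open>The chain is indexed by 0..n and takes values in a countable state space E. Conditional
  probabilities are constrained only given events of positive probability, since the library's
  elementary conditional probability is 0 given a null event.\<close>

definition markov_chain :: "'a measure \<Rightarrow> 'b set \<Rightarrow> nat \<Rightarrow> (nat \<Rightarrow> 'a \<Rightarrow> 'b) \<Rightarrow> bool" where
  "markov_chain M E n X \<longleftrightarrow>
     countable E \<and>
     (\<forall>i\<le>n. X i \<in> measurable M (count_space E)) \<and>
     (\<forall>i\<in>{1..n}. \<forall>x. \<forall>y\<in>E.
        (\<forall>j<i. x j \<in> E) \<longrightarrow>
        \<P>(\<omega> in M. \<forall>j<i. X j \<omega> = x j) > 0 \<longrightarrow>
        \<P>(\<omega> in M. X i \<omega> = y \<bar> \<forall>j<i. X j \<omega> = x j) =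
        \<P>(\<omega> in M. X i \<omega> = y \<bar> X (i - 1) \<omega> = x (i - 1)))"

definition sign_chain :: "'a measure \<Rightarrow> nat \<Rightarrow> real \<Rightarrow> (nat \<Rightarrow> 'a \<Rightarrow> real) \<Rightarrow> bool" where
  "sign_chain M n \<delta> S \<longleftrightarrow>
     markov_chain M {-1, 1} n S \<and>
     \<P>(\<omega> in M. S 0 \<omega> = 1) = 1 / 2 \<and>
     (\<forall>i\<in>{1..n}. \<forall>s\<in>{-1, 1}.
        \<P>(\<omega> in M. S (i - 1) \<omega> = s) > 0 \<longrightarrow>
        \<P>(\<omega> in M. S i \<omega> = s \<bar> S (i - 1) \<omega> = s) = 1 - \<delta> \<and>
        \<P>(\<omega> in M. S i \<omega> = - s \<bar> S (i - 1) \<omega> = s) = \<delta>)"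

definition rho_hat :: "nat \<Rightarrow> (real ^ 'd) \<Rightarrow> (nat \<Rightarrow> 'a \<Rightarrow> real) \<Rightarrow> 'a \<Rightarrow> real" where
  "rho_hat n \<theta> U \<omega> =
     1 / (norm \<theta>)\<^sup>2 * (2 / real n) * (\<Sum>i = 1..n div 2. U (2 * i) \<omega> * U (2 * i - 1) \<omega>)"

definition delta_hat :: "nat \<Rightarrow> (real ^ 'd) \<Rightarrow> (nat \<Rightarrow> 'a \<Rightarrow> real) \<Rightarrow> 'a \<Rightarrow> real" where
  "delta_hat n \<theta> U \<omega> = 1 / 2 * (1 - rho_hat n \<theta> U \<omega>)"

end

theory Submission
  imports Defs
begin

text \<open>The proof is a Chernoff bound for the sum T of the products of the paired observations. Given the
  signs, the pairs are independent and a Gaussian computation shows that the moment generating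
  function of each product depends on the signs only through their product, as a constant times
  its exponential. Averaging over the sign paths one transition at a time, the m = n/2 sign
  products behave like independent signs of mean 1 - 2\<delta>. With t the norm of the true parameter,
  each pair contributes at most exp(l t^2 (1 - 2\<delta>) + 5 l^2) to the moment generating function of T
  at l, so the choice l = 1/(2 sqrt n), with either sign, leaves a bounded factor exp(5/8) and a
  tail of order n^(-9).\<close>

section \<open>Exponential moments of products of Gaussians\<close>

text \<open>Completing the square turns the integrand into \<open>K\<close> times the normal density
  of mean \<open>d / (1 - 2 * c)\<close> and variance \<open>1 / (1 - 2 * c)\<close>; the condition
  on \<open>c\<close> keeps this variance positive.\<close>

lemma nn_integral_std_normal_exp_quadratic:
  fixes c d :: real
  assumes "c < 1 / 2"
  shows "(\<integral>\<^sup>+x. ennreal (std_normal_density x) * ennreal (exp (c * x\<^sup>2 + d * x)) \<partial>lborel)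
       = ennreal (exp (d\<^sup>2 / (2 * (1 - 2 * c))) / sqrt (1 - 2 * c))"
proof -
  define s where "s = 1 / sqrt (1 - 2 * c)"
  define \<mu> where "\<mu> = d / (1 - 2 * c)"
  define K where "K = exp (d\<^sup>2 / (2 * (1 - 2 * c))) / sqrt (1 - 2 * c)"
  have s: "s > 0" "s\<^sup>2 = 1 / (1 - 2 * c)" using assms by (simp_all add: s_def power_divide)
  have K: "K \<ge> 0" using assms by (simp add: K_def)
  have e: "std_normal_density x * exp (c * x\<^sup>2 + d * x) = K * normal_density \<mu> s x" for x
  proof -
    have "exp (- x\<^sup>2 / 2) * exp (c * x\<^sup>2 + d * x)
        = exp (d\<^sup>2 / (2 * (1 - 2 * c))) * exp (- (x - \<mu>)\<^sup>2 / (2 * s\<^sup>2))"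
    proof -
      have "- x\<^sup>2 / 2 + (c * x\<^sup>2 + d * x) = d\<^sup>2 / (2 * (1 - 2 * c)) + - (x - \<mu>)\<^sup>2 / (2 * s\<^sup>2)"
        using assms unfolding s(2) \<mu>_def
        by (simp add: divide_simps) (simp add: power2_eq_square algebra_simps)
      then show ?thesis by (simp flip: exp_add)
    qed
    moreover have "normal_density \<mu> s x = 1 / (sqrt (2 * pi) * s) * exp (- (x - \<mu>)\<^sup>2 / (2 * s\<^sup>2))"
      using s(1) unfolding normal_density_def by (simp add: real_sqrt_mult)
    moreover have "K = exp (d\<^sup>2 / (2 * (1 - 2 * c))) * s" by (simp add: K_def s_def)
    ultimately show ?thesis
      using s(1) unfolding std_normal_density_def by simp
  qed
  have "(\<integral>\<^sup>+x. ennreal (std_normal_density x) * ennreal (exp (c * x\<^sup>2 + d * x)) \<partial>lborel)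
      = (\<integral>\<^sup>+x. ennreal K * ennreal (normal_density \<mu> s x) \<partial>lborel)"
    by (intro nn_integral_cong) (simp add: e K flip: ennreal_mult)
  also have "\<dots> = ennreal K * (\<integral>\<^sup>+x. ennreal (normal_density \<mu> s x) \<partial>lborel)"
    by (intro nn_integral_cmult) auto
  also have "(\<integral>\<^sup>+x. ennreal (normal_density \<mu> s x) \<partial>lborel) = 1"
    using s by (subst nn_integral_eq_integral) auto
  finally show ?thesis by (simp add: K_def)
qed

text \<open>Two successive Gaussian integrals: with \<open>x\<close> fixed the exponent is linear in
  \<open>y\<close>, and integrating \<open>y\<close> out leaves an exponent quadratic in
  \<open>x\<close> with coefficient \<open>l\<^sup>2 / 2\<close>, which is below 1/2 because
  \<open>\<bar>l\<bar> < 1\<close>. If \<open>a\<close> and \<open>b\<close> are signs times a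
  common \<open>t\<close>, then \<open>a\<^sup>2 + b\<^sup>2\<close> is constant and the signs enter
  only through \<open>a * b\<close>.\<close>

lemma (in prob_space) nn_integral_exp_prod_std_normal:
  fixes a b l :: real and X Y :: "'a \<Rightarrow> real"
  assumes X: "distributed M lborel X std_normal_density"
    and Y: "distributed M lborel Y std_normal_density"
    and ind: "indep_var borel X borel Y"
    and l: "\<bar>l\<bar> < 1"
  shows "(\<integral>\<^sup>+\<omega>. ennreal (exp (l * ((a + X \<omega>) * (b + Y \<omega>)))) \<partial>M)
       = ennreal (exp ((l * a * b + l\<^sup>2 * (a\<^sup>2 + b\<^sup>2) / 2) / (1 - l\<^sup>2)) / sqrt (1 - l\<^sup>2))"
proof -
  have l2: "l\<^sup>2 < 1" using l by (simp add: abs_square_less_1)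
  \<comment> \<open>Densities refer to \<open>lborel\<close> and independence to
    \<open>borel\<close>; the two have the same measurable sets.\<close>
  have ind': "indep_var lborel X lborel Y"
    using ind by (simp add: indep_var_eq)
  have D: "distributed M (lborel \<Otimes>\<^sub>M lborel) (\<lambda>\<omega>. (X \<omega>, Y \<omega>))
             (\<lambda>(x, y). ennreal (std_normal_density x) * ennreal (std_normal_density y))"
    by (rule distributed_joint_indep[OF _ _ X Y ind']) (auto intro: lborel.sigma_finite_measure_axioms)
  define g where "g = (\<lambda>(x, y). ennreal (exp (l * ((a + x) * (b + y)))))"
  have "(\<integral>\<^sup>+\<omega>. ennreal (exp (l * ((a + X \<omega>) * (b + Y \<omega>)))) \<partial>M) = (\<integral>\<^sup>+\<omega>. g (X \<omega>, Y \<omega>) \<partial>M)"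
    by (simp add: g_def)
  also have "\<dots> = (\<integral>\<^sup>+z. (\<lambda>(x, y). ennreal (std_normal_density x) * ennreal (std_normal_density y)) z * g z
      \<partial>(lborel \<Otimes>\<^sub>M lborel))"
    by (rule distributed_nn_integral[OF D, symmetric]) (unfold g_def, measurable)
  also have "\<dots> = (\<integral>\<^sup>+x. \<integral>\<^sup>+y. ennreal (std_normal_density x) * ennreal (std_normal_density y) *
        ennreal (exp (l * ((a + x) * (b + y)))) \<partial>lborel \<partial>lborel)"
  proof (subst lborel.nn_integral_fst[symmetric])
    show "(\<lambda>z. (\<lambda>(x, y). ennreal (std_normal_density x) * ennreal (std_normal_density y)) z * g z)
        \<in> borel_measurable (lborel \<Otimes>\<^sub>M lborel)"
      unfolding g_def by measurable
  qed (simp add: g_def)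
  \<comment> \<open>The inner integral is the case \<open>c = 0\<close>,
    \<open>d = l * (a + x)\<close>; expanding its exponent in powers of \<open>x\<close> prepares
    the outer integral with \<open>c = l\<^sup>2 / 2\<close>.\<close>
  also have "\<dots> = (\<integral>\<^sup>+x. ennreal (exp (l * a * b + l\<^sup>2 * a\<^sup>2 / 2)) *
      (ennreal (std_normal_density x) * ennreal (exp (l\<^sup>2 / 2 * x\<^sup>2 + (l * b + l\<^sup>2 * a) * x))) \<partial>lborel)"
  proof (rule nn_integral_cong)
    fix x :: real
    have "(\<integral>\<^sup>+y. ennreal (std_normal_density x) * ennreal (std_normal_density y) *
        ennreal (exp (l * ((a + x) * (b + y)))) \<partial>lborel)
      = (\<integral>\<^sup>+y. ennreal (std_normal_density x * exp (l * (a + x) * b)) *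
          (ennreal (std_normal_density y) * ennreal (exp (0 * y\<^sup>2 + l * (a + x) * y))) \<partial>lborel)"
      by (intro nn_integral_cong) (simp add: algebra_simps flip: ennreal_mult exp_add)
    also have "\<dots> = ennreal (std_normal_density x * exp (l * (a + x) * b)) *
        (\<integral>\<^sup>+y. ennreal (std_normal_density y) * ennreal (exp (0 * y\<^sup>2 + l * (a + x) * y)) \<partial>lborel)"
      by (rule nn_integral_cmult) simp
    also have "\<dots> = ennreal (std_normal_density x * exp (l * (a + x) * b)) * ennreal (exp ((l * (a + x))\<^sup>2 / 2))"
      by (subst nn_integral_std_normal_exp_quadratic) simp_all
    also have "\<dots> = ennreal (std_normal_density x * exp (l * (a + x) * b + (l * (a + x))\<^sup>2 / 2))"
      by (simp add: exp_add mult.assoc flip: ennreal_mult)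
    also have "l * (a + x) * b + (l * (a + x))\<^sup>2 / 2
        = (l * a * b + l\<^sup>2 * a\<^sup>2 / 2) + (l\<^sup>2 / 2 * x\<^sup>2 + (l * b + l\<^sup>2 * a) * x)"
      by (simp add: power2_eq_square field_simps)
    also have "ennreal (std_normal_density x * exp \<dots>) = ennreal (exp (l * a * b + l\<^sup>2 * a\<^sup>2 / 2)) *
      (ennreal (std_normal_density x) * ennreal (exp (l\<^sup>2 / 2 * x\<^sup>2 + (l * b + l\<^sup>2 * a) * x)))"
      by (subst exp_add) (simp add: mult_ac flip: ennreal_mult)
    finally show "(\<integral>\<^sup>+y. ennreal (std_normal_density x) * ennreal (std_normal_density y) *
        ennreal (exp (l * ((a + x) * (b + y)))) \<partial>lborel) = \<dots>" .
  qed
  also have "\<dots> = ennreal (exp (l * a * b + l\<^sup>2 * a\<^sup>2 / 2)) *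
      (\<integral>\<^sup>+x. ennreal (std_normal_density x) * ennreal (exp (l\<^sup>2 / 2 * x\<^sup>2 + (l * b + l\<^sup>2 * a) * x)) \<partial>lborel)"
    by (rule nn_integral_cmult) simp
  also have "\<dots> = ennreal (exp (l * a * b + l\<^sup>2 * a\<^sup>2 / 2)) *
      ennreal (exp ((l * b + l\<^sup>2 * a)\<^sup>2 / (2 * (1 - l\<^sup>2))) / sqrt (1 - l\<^sup>2))"
    using l2 by (subst nn_integral_std_normal_exp_quadratic) simp_all
  also have "\<dots> = ennreal (exp (l * a * b + l\<^sup>2 * a\<^sup>2 / 2 + (l * b + l\<^sup>2 * a)\<^sup>2 / (2 * (1 - l\<^sup>2))) / sqrt (1 - l\<^sup>2))"
    using l2 by (simp add: exp_add flip: ennreal_mult)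
  also have "l * a * b + l\<^sup>2 * a\<^sup>2 / 2 + (l * b + l\<^sup>2 * a)\<^sup>2 / (2 * (1 - l\<^sup>2))
      = (l * a * b + l\<^sup>2 * (a\<^sup>2 + b\<^sup>2) / 2) / (1 - l\<^sup>2)"
    using l2 by (simp add: divide_simps) (simp add: power2_eq_square algebra_simps)
  finally show ?thesis .
qed

text \<open>By definition \<open>indep_var\<close> is independence of a family indexed by
  \<open>bool\<close>, so this is the product rule for finite independent families.\<close>

lemma (in prob_space) indep_var_nn_integral_mult:
  fixes X Y :: "'a \<Rightarrow> ennreal"
  assumes "indep_var borel X borel Y"
  shows "(\<integral>\<^sup>+\<omega>. X \<omega> * Y \<omega> \<partial>M) = (\<integral>\<^sup>+\<omega>. X \<omega> \<partial>M) * (\<integral>\<^sup>+\<omega>. Y \<omega> \<partial>M)"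
proof -
  have "case_bool borel borel = (\<lambda>_. borel :: ennreal measure)" by (auto split: bool.split)
  then have "indep_vars (\<lambda>_. borel) (case_bool X Y) UNIV"
    using assms unfolding indep_var_def by simp
  from indep_vars_nn_integral[OF _ this] show ?thesis by (simp add: UNIV_bool mult.commute)
qed

section \<open>Bounding the factor of a single pair\<close>

lemma exp_le_quadratic:
  fixes x :: real
  assumes "\<bar>x\<bar> \<le> 1"
  shows "exp x \<le> 1 + x + x\<^sup>2"
proof (cases "0 \<le> x")
  case True
  then show ?thesis using exp_bound assms by simp
next
  case False
  have "exp (- x) \<ge> 1 + (- x)" by (rule exp_ge_add_one_self)
  then have "exp x \<le> 1 / (1 - x)" using False by (simp add: exp_minus field_simps)
  \<comment> \<open>Here (1 - x)(1 + x + x^2) = 1 - x^3, which is at least 1 for negative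
    \<open>x\<close>.\<close>
  also have "\<dots> \<le> 1 + x + x\<^sup>2"
  proof -
    have "x * x\<^sup>2 \<le> 0" using False by (intro mult_nonpos_nonneg) auto
    then show ?thesis using False by (simp add: divide_simps) (simp add: power2_eq_square algebra_simps)
  qed
  finally show ?thesis .
qed

text \<open>The left side is the exact contribution of one pair: a Gaussian constant times the
  average of exp(\<plusminus>\<nu>) over the sign product. To first order in \<open>l\<close> the
  logarithm is \<open>l * t\<^sup>2 * (1 - 2 * \<delta>)\<close>; every other term is at most a
  constant times \<open>l\<^sup>2\<close>.\<close>

lemma noisy_sign_pair_mgf_bound:
  fixes l t \<delta> :: real
  defines "\<nu> \<equiv> l * t\<^sup>2 / (1 - l\<^sup>2)"
  assumes l: "\<bar>l\<bar> \<le> 1 / 2" and t: "0 \<le> t" "t \<le> 1" and \<delta>: "\<delta> \<in> {0..1}"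
  shows "exp (l\<^sup>2 * t\<^sup>2 / (1 - l\<^sup>2)) / sqrt (1 - l\<^sup>2) * ((1 - \<delta>) * exp \<nu> + \<delta> * exp (- \<nu>))
       \<le> exp (l * t\<^sup>2 * (1 - 2 * \<delta>) + 5 * l\<^sup>2)"
proof -
  define x where "x = l\<^sup>2"
  have x: "0 \<le> x" "x \<le> 1 / 4"
    using l power_mono[of "\<bar>l\<bar>" "1/2" 2] by (simp_all add: x_def power2_eq_square)
  have t2: "0 \<le> t\<^sup>2" "t\<^sup>2 \<le> 1" using t by (simp_all add: power_le_one)
  have inv: "1 / (1 - x) \<le> 4 / 3" using x by (simp add: field_simps)
  \<comment> \<open>Half of the logarithmic estimate ln(1 - x) \<ge> -x - 2x^2 \<ge> -2x, valid
    since x \<le> 1/4.\<close>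
  have "exp (- x) \<le> sqrt (1 - x)"
  proof -
    have "- 2 * x \<le> - x - 2 * x\<^sup>2" using x mult_left_mono[of x "1/4" x] by (simp add: power2_eq_square)
    also have "\<dots> \<le> ln (1 - x)" using x ln_one_minus_pos_lower_bound by simp
    finally have "exp (- 2 * x) \<le> 1 - x" using x by (subst (asm) ln_ge_iff) auto
    moreover have "exp (- 2 * x) = (exp (- x))\<^sup>2" by (simp add: power2_eq_square flip: exp_add)
    ultimately show ?thesis by (simp add: real_le_rsqrt)
  qed
  then have sq: "1 / sqrt (1 - x) \<le> exp x" using x by (simp add: exp_minus field_simps)
  \<comment> \<open>The factor by which \<nu> exceeds \<open>l\<close>; it is at most 4/3, so
    \<bar>\<nu>\<bar> is at most 2/3 and the quadratic bound on \<open>exp\<close> applies to both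
    signs.\<close>
  define f where "f = t\<^sup>2 * (1 / (1 - x))"
  have \<nu>: "\<nu> = l * f" by (simp add: \<nu>_def x_def f_def)
  have f: "0 \<le> f" "f \<le> 4 / 3"
    unfolding f_def using t2 x inv mult_mono[of "t\<^sup>2" 1 "1 / (1 - x)" "4/3"] by simp_all
  have \<nu>1: "\<bar>\<nu>\<bar> \<le> 1"
    using mult_mono[of "\<bar>l\<bar>" "1/2" "f" "4/3"] l f by (simp add: \<nu> abs_mult)
  have \<nu>2: "\<nu>\<^sup>2 \<le> 16 / 9 * x"
  proof -
    have "f\<^sup>2 \<le> (4/3)\<^sup>2" using f by (intro power_mono)
    then show ?thesis using mult_left_mono[of "f\<^sup>2" "16/9" x] x
      unfolding \<nu> power_mult_distrib[of l] x_def[symmetric] by (simp add: power_divide)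
  qed
  \<comment> \<open>The sign product has mean 1 - 2\<delta> and square 1, so averaging the quadratic
    bound keeps these two moments.\<close>
  have "(1 - \<delta>) * exp \<nu> + \<delta> * exp (- \<nu>) \<le> (1 - \<delta>) * (1 + \<nu> + \<nu>\<^sup>2) + \<delta> * (1 + (- \<nu>) + (- \<nu>)\<^sup>2)"
    using \<nu>1 \<delta> by (intro add_mono mult_left_mono exp_le_quadratic) auto
  also have "\<dots> = 1 + (\<nu> * (1 - 2 * \<delta>) + \<nu>\<^sup>2)" by (simp add: algebra_simps)
  also have "\<dots> \<le> exp (\<nu> * (1 - 2 * \<delta>) + \<nu>\<^sup>2)" by (rule exp_ge_add_one_self)
  finally have h: "(1 - \<delta>) * exp \<nu> + \<delta> * exp (- \<nu>) \<le> exp (\<nu> * (1 - 2 * \<delta>) + \<nu>\<^sup>2)" .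
  \<comment> \<open>Since f - t^2 = x f, replacing \<nu> by l t^2 costs only a term of order
    \<open>x\<close>.\<close>
  have "\<nu> * (1 - 2 * \<delta>) - l * t\<^sup>2 * (1 - 2 * \<delta>) = (l * (1 - 2 * \<delta>)) * (x * f)"
    using x by (simp add: \<nu> f_def divide_simps) (simp add: algebra_simps)
  also have "\<dots> \<le> \<bar>l * (1 - 2 * \<delta>)\<bar> * (x * f)"
    using x f by (intro mult_right_mono) auto
  also have "\<dots> \<le> (1 / 2) * (x * (4 / 3))"
  proof (intro mult_mono)
    show "\<bar>l * (1 - 2 * \<delta>)\<bar> \<le> 1 / 2"
      using l \<delta> mult_mono[of "\<bar>l\<bar>" "1/2" "\<bar>1 - 2 * \<delta>\<bar>" 1] by (auto simp: abs_mult)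
  qed (use x f in auto)
  finally have d: "\<nu> * (1 - 2 * \<delta>) \<le> l * t\<^sup>2 * (1 - 2 * \<delta>) + 2 / 3 * x" by simp
  have e: "x * t\<^sup>2 / (1 - x) \<le> 4 / 3 * x"
    using mult_left_mono[OF f(2) x(1)] by (simp add: f_def)
  have "exp (x * t\<^sup>2 / (1 - x)) / sqrt (1 - x) * ((1 - \<delta>) * exp \<nu> + \<delta> * exp (- \<nu>))
      = exp (x * t\<^sup>2 / (1 - x)) * (1 / sqrt (1 - x)) * ((1 - \<delta>) * exp \<nu> + \<delta> * exp (- \<nu>))" by simp
  also have "\<dots> \<le> exp (4 / 3 * x) * exp x * exp (\<nu> * (1 - 2 * \<delta>) + \<nu>\<^sup>2)"
    using e sq h x \<delta> by (intro mult_mono) auto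
  also have "\<dots> = exp (4 / 3 * x + x + (\<nu> * (1 - 2 * \<delta>) + \<nu>\<^sup>2))" by (simp only: exp_add)
  \<comment> \<open>The coefficients of \<open>x\<close> add up to 4/3 + 1 + 2/3 + 16/9 = 43/9,
    below 5.\<close>
  also have "\<dots> \<le> exp (l * t\<^sup>2 * (1 - 2 * \<delta>) + 5 * x)"
    using d \<nu>2 x by simp
  finally show ?thesis by (simp add: x_def)
qed

section \<open>Path probabilities of the sign chain\<close>

text \<open>Used to sum out the last state of a path: extending a path by a value at
  \<open>k\<close> is a bijection onto the longer paths.\<close>

lemma sum_PiE_lessThan_Suc:
  assumes "finite E"
  shows "(\<Sum>x\<in>PiE {..<Suc k} (\<lambda>_. E). f x) = (\<Sum>x\<in>PiE {..<k} (\<lambda>_. E). \<Sum>y\<in>E. f (x(k := y)))"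
proof -
  have "(\<Sum>x\<in>PiE {..<Suc k} (\<lambda>_. E). f x) = (\<Sum>(y, x)\<in>E \<times> PiE {..<k} (\<lambda>_. E). f (x(k := y)))"
    unfolding lessThan_Suc PiE_insert_eq
    by (subst sum.reindex) (auto intro!: inj_combinator simp: case_prod_beta)
  also have "\<dots> = (\<Sum>y\<in>E. \<Sum>x\<in>PiE {..<k} (\<lambda>_. E). f (x(k := y)))"
    by (rule sum.cartesian_product[symmetric])
  also have "\<dots> = (\<Sum>x\<in>PiE {..<k} (\<lambda>_. E). \<Sum>y\<in>E. f (x(k := y)))" by (rule sum.swap)
  finally show ?thesis .
qed

context prob_space
begin

lemma sign_chain_event:
  assumes "sign_chain M n \<delta> S" "j \<le> n"
  shows "{\<omega>\<in>space M. S j \<omega> = y} \<in> events"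
proof -
  have S: "S j \<in> measurable M (count_space {-1, 1})"
    using assms by (simp add: sign_chain_def markov_chain_def)
  \<comment> \<open>Intersecting with the state space also covers values \<open>y\<close> that the
    chain never takes.\<close>
  have "{\<omega>\<in>space M. S j \<omega> = y} = S j -` ({y} \<inter> {-1, 1}) \<inter> space M"
    using measurable_space[OF S] by auto
  also have "\<dots> \<in> events"
    by (rule measurable_sets[OF S]) simp
  finally show ?thesis .
qed

text \<open>The Markov property replaces conditioning on the whole prefix by conditioning on the
  last state, where the transition law is prescribed.\<close>

lemma sign_chain_prob_path_Suc:
  assumes ch: "sign_chain M n \<delta> S" and i: "i \<in> {1..n}" and x: "\<And>j. j \<le> i \<Longrightarrow> x j \<in> {-1, 1}"
  shows "\<P>(\<omega> in M. \<forall>j<Suc i. S j \<omega> = x j) =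
         \<P>(\<omega> in M. \<forall>j<i. S j \<omega> = x j) * (if x i = x (i - 1) then 1 - \<delta> else \<delta>)"
proof -
  have mc: "markov_chain M {-1, 1} n S" using ch by (simp add: sign_chain_def)
  have meas: "{\<omega>\<in>space M. S j \<omega> = y} \<in> events" if "j \<le> n" for j y
    using sign_chain_event[OF ch that] .
  let ?A = "{\<omega>\<in>space M. \<forall>j<i. S j \<omega> = x j}"
  let ?B = "{\<omega>\<in>space M. S i \<omega> = x i \<and> (\<forall>j<i. S j \<omega> = x j)}"
  have eq: "{\<omega>\<in>space M. \<forall>j<Suc i. S j \<omega> = x j} = ?B" by (auto simp: less_Suc_eq)
  have mA: "?A \<in> events" using i meas by (auto intro!: sets.sets_Collect_finite_All)
  show ?thesis
  proof (cases "prob ?A > 0")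
    case False
    \<comment> \<open>Given a null prefix the chain axioms prescribe nothing; both sides vanish by
      monotonicity.\<close>
    then have "prob ?A = 0" using measure_nonneg[of M ?A] by linarith
    moreover have "prob ?B \<le> prob ?A" by (intro finite_measure_mono mA) auto
    ultimately show ?thesis unfolding eq using measure_nonneg[of M ?B] by simp
  next
    case True
    \<comment> \<open>The transition law is available only from states of positive probability; the
      prefix event lies inside the event of its last state.\<close>
    have "prob ?A \<le> \<P>(\<omega> in M. S (i - 1) \<omega> = x (i - 1))"
      using i meas by (intro finite_measure_mono) auto
    with True have pos: "\<P>(\<omega> in M. S (i - 1) \<omega> = x (i - 1)) > 0" by linarith
    have "\<P>(\<omega> in M. S i \<omega> = x i \<bar> \<forall>j<i. S j \<omega> = x j) = \<P>(\<omega> in M. S i \<omega> = x i \<bar> S (i - 1) \<omega> = x (i - 1))"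
      by (rule mc[unfolded markov_chain_def, THEN conjunct2, THEN conjunct2, rule_format, OF i _ _ True])
        (simp_all only: x order_refl less_imp_le)
    also have "\<dots> = (if x i = x (i - 1) then 1 - \<delta> else \<delta>)"
    proof -
      have s: "x (i - 1) \<in> {-1, 1}" "x i \<in> {-1, 1}" using x i by auto
      have p: "\<P>(\<omega> in M. S i \<omega> = x (i - 1) \<bar> S (i - 1) \<omega> = x (i - 1)) = 1 - \<delta>"
        "\<P>(\<omega> in M. S i \<omega> = - x (i - 1) \<bar> S (i - 1) \<omega> = x (i - 1)) = \<delta>"
        using ch[unfolded sign_chain_def, THEN conjunct2, THEN conjunct2, rule_format, OF i s(1) pos]
        by blast+
      consider "x i = x (i - 1)" | "x i = - x (i - 1)" "x i \<noteq> x (i - 1)"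
        using s by (metis insertE minus_minus singletonD)
      then show ?thesis
      proof cases
        case 1
        show ?thesis using p(1) unfolding 1 by simp
      next
        case 2
        show ?thesis using p(2) 2(2) unfolding 2(1) by simp
      qed
    qed
    finally have cond: "prob ?B / prob ?A = (if x i = x (i - 1) then 1 - \<delta> else \<delta>)"
      unfolding cond_prob_def .
    have "prob ?B = prob ?A * (prob ?B / prob ?A)" using True by simp
    then show ?thesis unfolding eq cond .
  qed
qed

text \<open>From either state the product \<open>x i * x (i - 1)\<close> is 1 with weight 1 -
  \<delta> and -1 with weight \<delta>, so the last factor splits off independently of the prefix.
  \<open>F\<close> carries the weights of earlier pairs; constant \<open>g = 1\<close> gives plain
  marginalisation.\<close>

lemma sign_chain_sum_path_Suc:
  assumes ch: "sign_chain M n \<delta> S" and i: "i \<in> {1..n}"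
    and F: "\<And>x y. F (x(i := y)) = F x"
  shows "(\<Sum>x\<in>PiE {..<Suc i} (\<lambda>_. {-1, 1}). \<P>(\<omega> in M. \<forall>j<Suc i. S j \<omega> = x j) * (F x * g (x i * x (i - 1))))
       = (\<Sum>x\<in>PiE {..<i} (\<lambda>_. {-1, 1}). \<P>(\<omega> in M. \<forall>j<i. S j \<omega> = x j) * F x) * ((1 - \<delta>) * g 1 + \<delta> * g (- 1 :: real))"
  unfolding sum_distrib_right
proof (subst sum_PiE_lessThan_Suc, simp, rule sum.cong[OF refl])
  fix x :: "nat \<Rightarrow> real" assume x: "x \<in> PiE {..<i} (\<lambda>_. {-1, 1})"
  have x1: "x (i - 1) \<in> {-1, 1}" using i PiE_mem[OF x, of "i - 1"] by simp
  have *: "\<P>(\<omega> in M. \<forall>j<Suc i. S j \<omega> = (x(i := y)) j) = \<P>(\<omega> in M. \<forall>j<i. S j \<omega> = x j) * (if y = x (i - 1) then 1 - \<delta> else \<delta>)"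
    if "y \<in> {-1, 1}" for y
  proof -
    have "(x(i := y)) j \<in> {-1, 1}" if "j \<le> i" for j
      using \<open>y \<in> {-1, 1}\<close> PiE_mem[OF x, of j] that by auto
    then have "\<P>(\<omega> in M. \<forall>j<Suc i. S j \<omega> = (x(i := y)) j) = \<P>(\<omega> in M. \<forall>j<i. S j \<omega> = (x(i := y)) j) *
        (if (x(i := y)) i = (x(i := y)) (i - 1) then 1 - \<delta> else \<delta>)"
      by (rule sign_chain_prob_path_Suc[OF ch i])
    moreover have "(\<forall>j<i. S j \<omega> = (x(i := y)) j) \<longleftrightarrow> (\<forall>j<i. S j \<omega> = x j)" for \<omega>
      by auto
    moreover have "(x(i := y)) (i - 1) = x (i - 1)" using i by auto
    ultimately show ?thesis by (simp only: fun_upd_same)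
  qed
  show "(\<Sum>y\<in>{-1, 1}. \<P>(\<omega> in M. \<forall>j<Suc i. S j \<omega> = (x(i := y)) j) *
         (F (x(i := y)) * g ((x(i := y)) i * (x(i := y)) (i - 1))))
      = \<P>(\<omega> in M. \<forall>j<i. S j \<omega> = x j) * F x * ((1 - \<delta>) * g 1 + \<delta> * g (- 1))"
  proof -
    have upd: "(x(i := y)) (i - 1) = x (i - 1)" for y using i by auto
    have "(\<Sum>y\<in>{-1, 1}. \<P>(\<omega> in M. \<forall>j<Suc i. S j \<omega> = (x(i := y)) j) *
         (F (x(i := y)) * g ((x(i := y)) i * (x(i := y)) (i - 1))))
      = (\<Sum>y\<in>{-1, 1}. \<P>(\<omega> in M. \<forall>j<i. S j \<omega> = x j) * (if y = x (i - 1) then 1 - \<delta> else \<delta>) *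
         (F x * g (y * x (i - 1))))"
      by (intro sum.cong refl) (simp only: * F upd fun_upd_same)
    also have "\<dots> = \<P>(\<omega> in M. \<forall>j<i. S j \<omega> = x j) * F x * ((1 - \<delta>) * g 1 + \<delta> * g (- 1))"
    proof -
      from x1 consider "x (i - 1) = -1" | "x (i - 1) = 1" by auto
      then show ?thesis by cases (simp_all add: algebra_simps)
    qed
    finally show ?thesis .
  qed
qed

text \<open>Induction removing two states per pair: the transition inside the pair yields the
  factor, the one before it yields 1. Paths have length \<open>Suc (2 * k)\<close> because time 0
  belongs to the chain but to no pair.\<close>

lemma sign_chain_sum_pairs:
  assumes ch: "sign_chain M n \<delta> S" and "2 * k \<le> n"
  shows "(\<Sum>x\<in>PiE {..<Suc (2 * k)} (\<lambda>_. {-1, 1}). \<P>(\<omega> in M. \<forall>j<Suc (2 * k). S j \<omega> = x j) *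
            (\<Prod>i = 1..k. g (x (2 * i) * x (2 * i - 1))))
       = ((1 - \<delta>) * g 1 + \<delta> * g (- 1 :: real)) ^ k"
  using \<open>2 * k \<le> n\<close>
proof (induction k)
  case 0
  have S0: "S 0 \<in> measurable M (count_space {-1, 1})"
    using ch by (simp add: sign_chain_def markov_chain_def)
  \<comment> \<open>With no pairs the sum is the total mass of the law of
    \<open>S 0\<close>.\<close>
  have "\<P>(\<omega> in M. S 0 \<omega> = -1) + \<P>(\<omega> in M. S 0 \<omega> = 1) = prob ({\<omega>\<in>space M. S 0 \<omega> = -1} \<union> {\<omega>\<in>space M. S 0 \<omega> = 1})"
    by (rule finite_measure_Union[symmetric]) (auto intro!: sign_chain_event[OF ch])
  also have "{\<omega>\<in>space M. S 0 \<omega> = -1} \<union> {\<omega>\<in>space M. S 0 \<omega> = 1} = space M"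
    using measurable_space[OF S0] by auto
  finally show ?case
    by (subst sum_PiE_lessThan_Suc) (simp_all add: prob_space)
next
  case (Suc k)
  let ?F = "\<lambda>x. \<Prod>i = 1..k. g (x (2 * i) * x (2 * i - 1))"
  have "(\<Sum>x\<in>PiE {..<Suc (2 * Suc k)} (\<lambda>_. {-1, 1}). \<P>(\<omega> in M. \<forall>j<Suc (2 * Suc k). S j \<omega> = x j) *
            (\<Prod>i = 1..Suc k. g (x (2 * i) * x (2 * i - 1))))
     = (\<Sum>x\<in>PiE {..<Suc (2 * Suc k)} (\<lambda>_. {-1, 1}). \<P>(\<omega> in M. \<forall>j<Suc (2 * Suc k). S j \<omega> = x j) *
            (?F x * g (x (2 * Suc k) * x (2 * Suc k - 1))))"
    by simp
  also have "\<dots> = (\<Sum>x\<in>PiE {..<2 * Suc k} (\<lambda>_. {-1, 1}). \<P>(\<omega> in M. \<forall>j<2 * Suc k. S j \<omega> = x j) * ?F x) *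
      ((1 - \<delta>) * g 1 + \<delta> * g (- 1))"
    using Suc.prems by (intro sign_chain_sum_path_Suc[OF ch] prod.cong) auto
  \<comment> \<open>The transition between two consecutive pairs is summed out with \<open>g = 1\<close>.\<close>
  also have "2 * Suc k = Suc (2 * k + 1)" by simp
  also have "(\<Sum>x\<in>PiE {..<Suc (2 * k + 1)} (\<lambda>_. {-1, 1}). \<P>(\<omega> in M. \<forall>j<Suc (2 * k + 1). S j \<omega> = x j) * ?F x)
      = (\<Sum>x\<in>PiE {..<2 * k + 1} (\<lambda>_. {-1, 1}). \<P>(\<omega> in M. \<forall>j<2 * k + 1. S j \<omega> = x j) * ?F x)"
  proof -
    have "?F (x(2 * k + 1 := y)) = ?F x" for x y by (intro prod.cong) auto
    from sign_chain_sum_path_Suc[OF ch _ this, of "\<lambda>_. 1"] show ?thesis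
      using Suc.prems by simp
  qed
  finally show ?case using Suc by simp
qed

section \<open>Moment generating function of the sum of paired products\<close>

text \<open>The noise with the signs frozen in \<open>a\<close>: the index blocks are disjoint, so
  the factors are independent, and each is a two-variable Gaussian integral.\<close>

lemma nn_integral_prod_exp_std_normal_pairs:
  fixes W :: "nat \<Rightarrow> 'a \<Rightarrow> real"
  assumes W: "\<And>i. i \<in> {1..2 * m} \<Longrightarrow> distributed M lborel (W i) std_normal_density"
    and ind: "indep_vars (\<lambda>_. borel) W {1..2 * m}"
    and l: "\<bar>l\<bar> < 1"
  shows "(\<integral>\<^sup>+\<omega>. (\<Prod>i = 1..m. ennreal (exp (l * ((a (2 * i) + W (2 * i) \<omega>) * (a (2 * i - 1) + W (2 * i - 1) \<omega>))))) \<partial>M)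
       = (\<Prod>i = 1..m. ennreal (exp ((l * a (2 * i) * a (2 * i - 1) + l\<^sup>2 * ((a (2 * i))\<^sup>2 + (a (2 * i - 1))\<^sup>2) / 2) / (1 - l\<^sup>2))
            / sqrt (1 - l\<^sup>2)))"
proof -
  have "indep_vars (\<lambda>i. PiM {2 * i - 1, 2 * i} (\<lambda>_. borel)) (\<lambda>i \<omega>. restrict (\<lambda>j. W j \<omega>) {2 * i - 1, 2 * i}) {1..m}"
  proof (rule indep_vars_restrict[OF ind])
    \<comment> \<open>The block number is recovered from any index in it, hence blocks are
      disjoint.\<close>
    have half: "(k + 1) div 2 = i" if "i \<in> {1..m}" "k \<in> {2 * i - 1, 2 * i}" for i k
    proof -
      have "k + 1 = 2 * i \<or> k + 1 = 2 * i + 1" using that by auto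
      then show ?thesis by auto
    qed
    show "disjoint_family_on (\<lambda>i. {2 * i - 1, 2 * i}) {1..m}"
      unfolding disjoint_family_on_def
    proof (intro ballI impI equals0I)
      fix i j k assume "i \<in> {1..m}" "j \<in> {1..m}" "i \<noteq> j"
        and "k \<in> {2 * i - 1, 2 * i} \<inter> {2 * j - 1, 2 * j}"
      then show False using half[of i k] half[of j k] by simp
    qed
  qed auto
  then have "indep_vars (\<lambda>_. borel) (\<lambda>i \<omega>. (\<lambda>w. ennreal (exp (l * ((a (2 * i) + w (2 * i)) * (a (2 * i - 1) + w (2 * i - 1))))))
      (restrict (\<lambda>j. W j \<omega>) {2 * i - 1, 2 * i})) {1..m}"
    by (rule indep_vars_compose2) measurable
  then have "indep_vars (\<lambda>_. borel) (\<lambda>i \<omega>. ennreal (exp (l * ((a (2 * i) + W (2 * i) \<omega>) * (a (2 * i - 1) + W (2 * i - 1) \<omega>))))) {1..m}"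
    by simp
  from indep_vars_nn_integral[OF _ this] show ?thesis
  proof (simp only: finite_atLeastAtMost zero_le simp_thms, intro prod.cong refl)
    fix i assume i: "i \<in> {1..m}"
    then have sub: "{2 * i, 2 * i - 1} \<subseteq> {1..2 * m}" "2 * i \<notin> {2 * i - 1}" by auto
    \<comment> \<open>Pairwise independence is read off as independence from a sum over one
      index.\<close>
    have "indep_var borel (W (2 * i)) borel (W (2 * i - 1))"
      using indep_vars_sum[OF _ sub(2) indep_vars_subset[OF ind sub(1)]] by simp
    with i show "(\<integral>\<^sup>+\<omega>. ennreal (exp (l * ((a (2 * i) + W (2 * i) \<omega>) * (a (2 * i - 1) + W (2 * i - 1) \<omega>)))) \<partial>M)
        = ennreal (exp ((l * a (2 * i) * a (2 * i - 1) + l\<^sup>2 * ((a (2 * i))\<^sup>2 + (a (2 * i - 1))\<^sup>2) / 2) / (1 - l\<^sup>2)) / sqrt (1 - l\<^sup>2))"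
      by (intro nn_integral_exp_prod_std_normal W l) auto
  qed
qed

text \<open>The integrand is split over the finitely many sign paths. On each path independence of
  \<open>S\<close> and \<open>W\<close> factors the integral into a path probability and a Gaussian
  term that depends on the path through its pair products only; summing over paths gives an
  \<open>m\<close>-th power.\<close>

lemma nn_integral_exp_noisy_sign_chain:
  fixes S W :: "nat \<Rightarrow> 'a \<Rightarrow> real" and t l :: real
  assumes ch: "sign_chain M (2 * m) \<delta> S"
    and W: "\<And>i. i \<in> {1..2 * m} \<Longrightarrow> distributed M lborel (W i) std_normal_density"
    and ind: "indep_vars (\<lambda>_. borel) W {1..2 * m}"
    and SW: "indep_var (PiM {0..2 * m} (\<lambda>_. count_space {-1, 1})) (\<lambda>\<omega>. \<lambda>i\<in>{0..2 * m}. S i \<omega>)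
           (PiM {1..2 * m} (\<lambda>_. borel)) (\<lambda>\<omega>. \<lambda>i\<in>{1..2 * m}. W i \<omega>)"
    and l: "\<bar>l\<bar> < 1" and \<delta>: "\<delta> \<in> {0..1}"
  defines "\<nu> \<equiv> l * t\<^sup>2 / (1 - l\<^sup>2)"
  shows "(\<integral>\<^sup>+\<omega>. ennreal (exp (l * (\<Sum>i = 1..m. (t * S (2 * i) \<omega> + W (2 * i) \<omega>) *
             (t * S (2 * i - 1) \<omega> + W (2 * i - 1) \<omega>)))) \<partial>M)
       = ennreal ((exp (l\<^sup>2 * t\<^sup>2 / (1 - l\<^sup>2)) / sqrt (1 - l\<^sup>2) * ((1 - \<delta>) * exp \<nu> + \<delta> * exp (- \<nu>))) ^ m)"
proof -
  define Q where "Q = PiE {..<Suc (2 * m)} (\<lambda>_. {-1, 1 :: real})"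
  define G where "G x w = (\<Prod>i = 1..m. ennreal (exp (l * ((t * x (2 * i) + w (2 * i)) * (t * x (2 * i - 1) + w (2 * i - 1))))))"
    for x w :: "nat \<Rightarrow> real"
  \<comment> \<open>The path indicator as a product over coordinates, so that its measurability on
    the product space comes from the projections.\<close>
  define I where "I x v = (\<Prod>j\<in>{0..2 * m}. indicator {x j} (v j) :: ennreal)" for x v :: "nat \<Rightarrow> real"
  define c where "c = exp (l\<^sup>2 * t\<^sup>2 / (1 - l\<^sup>2)) / sqrt (1 - l\<^sup>2)"
  have l2: "l\<^sup>2 < 1" using l by (simp add: abs_square_less_1)
  then have c: "0 \<le> c" by (simp add: c_def)
  have finQ: "finite Q" by (simp add: Q_def finite_PiE)
  let ?S = "\<lambda>\<omega>. \<lambda>i\<in>{0..2 * m}. S i \<omega>" and ?W = "\<lambda>\<omega>. \<lambda>i\<in>{1..2 * m}. W i \<omega>"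
  have Sm: "S j \<in> measurable M (count_space {-1, 1})" if "j \<le> 2 * m" for j
    using ch that by (simp add: sign_chain_def markov_chain_def)
  have I_eq: "I x (?S \<omega>) = (if \<forall>j<Suc (2 * m). S j \<omega> = x j then 1 else 0)" for x \<omega>
  proof -
    have "I x (?S \<omega>) = (\<Prod>j\<in>{0..2 * m}. if S j \<omega> = x j then 1 else 0)"
      unfolding I_def by (intro prod.cong) (auto simp: indicator_def)
    then show ?thesis by (auto simp: less_Suc_eq_le intro!: prod_zero)
  qed
  have G_eq: "G x (?W \<omega>) = G x (\<lambda>i. W i \<omega>)" for x \<omega>
    unfolding G_def by (intro prod.cong) auto
  have mI: "I x \<in> borel_measurable (PiM {0..2 * m} (\<lambda>_. count_space {-1, 1}))" for x
    unfolding I_def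
  proof (rule borel_measurable_prod_ennreal)
    fix j assume "j \<in> {0..2 * m}"
    then have "(\<lambda>v. v j) \<in> measurable (PiM {0..2 * m} (\<lambda>_. count_space {-1, 1 :: real})) (count_space {-1, 1})"
      by (rule measurable_component_singleton)
    then show "(\<lambda>v. indicator {x j} (v j)) \<in> borel_measurable (PiM {0..2 * m} (\<lambda>_. count_space {-1, 1 :: real}))"
      by (rule measurable_compose[OF _ borel_measurable_count_space])
  qed
  have mG: "G x \<in> borel_measurable (PiM {1..2 * m} (\<lambda>_. borel))" for x
  proof -
    have "(\<lambda>w. ennreal (exp (l * ((t * x (2 * i) + w (2 * i)) * (t * x (2 * i - 1) + w (2 * i - 1))))))
        \<in> borel_measurable (PiM {1..2 * m} (\<lambda>_. borel))" if "i \<in> {1..m}" for i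
    proof -
      have [measurable]: "(\<lambda>w. w (2 * i)) \<in> borel_measurable (PiM {1..2 * m} (\<lambda>_. borel :: real measure))"
        "(\<lambda>w. w (2 * i - 1)) \<in> borel_measurable (PiM {1..2 * m} (\<lambda>_. borel :: real measure))"
        using that by (auto intro!: measurable_component_singleton)
      show ?thesis by measurable
    qed
    then show ?thesis unfolding G_def by (rule borel_measurable_prod_ennreal)
  qed
  have IG: "indep_var borel (\<lambda>\<omega>. I x (?S \<omega>)) borel (\<lambda>\<omega>. G x (?W \<omega>))" for x
    using indep_var_compose[OF SW mI mG, of x x] by (simp add: comp_def)
  note mIG = indep_var_rv1[OF IG] indep_var_rv2[OF IG]
  have path: "(\<integral>\<^sup>+\<omega>. I x (?S \<omega>) \<partial>M) = ennreal (\<P>(\<omega> in M. \<forall>j<Suc (2 * m). S j \<omega> = x j))" for x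
  proof -
    have "{\<omega>\<in>space M. \<forall>j<Suc (2 * m). S j \<omega> = x j} \<in> events"
    proof -
      have "{\<omega>\<in>space M. \<forall>j\<in>{..<Suc (2 * m)}. S j \<omega> = x j} \<in> events"
        by (intro sets.sets_Collect_finite_All sign_chain_event[OF ch]) auto
      then show ?thesis by (simp only: Ball_def lessThan_iff)
    qed
    then have "(\<integral>\<^sup>+\<omega>. indicator {\<omega>\<in>space M. \<forall>j<Suc (2 * m). S j \<omega> = x j} \<omega> \<partial>M)
        = ennreal (\<P>(\<omega> in M. \<forall>j<Suc (2 * m). S j \<omega> = x j))"
      by (simp only: nn_integral_indicator emeasure_eq_measure)
    moreover have "(\<integral>\<^sup>+\<omega>. I x (?S \<omega>) \<partial>M) = (\<integral>\<^sup>+\<omega>. indicator {\<omega>\<in>space M. \<forall>j<Suc (2 * m). S j \<omega> = x j} \<omega> \<partial>M)"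
      by (intro nn_integral_cong) (simp add: I_eq indicator_def)
    ultimately show ?thesis by (simp only:)
  qed
  have noise: "(\<integral>\<^sup>+\<omega>. G x (?W \<omega>) \<partial>M) = ennreal (\<Prod>i = 1..m. c * exp (\<nu> * (x (2 * i) * x (2 * i - 1))))"
    if x: "x \<in> Q" for x
  proof -
    have "(\<integral>\<^sup>+\<omega>. G x (?W \<omega>) \<partial>M) = (\<Prod>i = 1..m. ennreal (c * exp (\<nu> * (x (2 * i) * x (2 * i - 1)))))"
      unfolding G_eq unfolding G_def
    proof (subst nn_integral_prod_exp_std_normal_pairs[OF W ind l, where a = "\<lambda>j. t * x j"], assumption, intro prod.cong refl arg_cong[where f = ennreal])
      fix i assume i: "i \<in> {1..m}"
      have "x (2 * i) \<in> {-1, 1}" "x (2 * i - 1) \<in> {-1, 1}"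
        using i PiE_mem[OF x[unfolded Q_def], of "2 * i"] PiE_mem[OF x[unfolded Q_def], of "2 * i - 1"] by auto
      then have sq: "(x (2 * i))\<^sup>2 = 1" "(x (2 * i - 1))\<^sup>2 = 1" by auto
      \<comment> \<open>As the signs square to 1, the exponent is a constant, absorbed in
        \<open>c\<close>, plus \<nu> times the sign product.\<close>
      have "(l * (t * x (2 * i)) * (t * x (2 * i - 1)) + l\<^sup>2 * ((t * x (2 * i))\<^sup>2 + (t * x (2 * i - 1))\<^sup>2) / 2) / (1 - l\<^sup>2)
          = l\<^sup>2 * t\<^sup>2 / (1 - l\<^sup>2) + \<nu> * (x (2 * i) * x (2 * i - 1))"
        unfolding power_mult_distrib sq \<nu>_def by (simp add: power2_eq_square add_divide_distrib mult_ac)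
      then show "exp ((l * (t * x (2 * i)) * (t * x (2 * i - 1)) + l\<^sup>2 * ((t * x (2 * i))\<^sup>2 + (t * x (2 * i - 1))\<^sup>2) / 2) / (1 - l\<^sup>2)) / sqrt (1 - l\<^sup>2)
          = c * exp (\<nu> * (x (2 * i) * x (2 * i - 1)))"
        by (simp only: c_def exp_add times_divide_eq_left)
    qed
    also have "\<dots> = ennreal (\<Prod>i = 1..m. c * exp (\<nu> * (x (2 * i) * x (2 * i - 1))))"
      using c by (intro prod_ennreal) simp
    finally show ?thesis .
  qed
  have "(\<integral>\<^sup>+\<omega>. ennreal (exp (l * (\<Sum>i = 1..m. (t * S (2 * i) \<omega> + W (2 * i) \<omega>) *
             (t * S (2 * i - 1) \<omega> + W (2 * i - 1) \<omega>)))) \<partial>M) = (\<integral>\<^sup>+\<omega>. (\<Sum>x\<in>Q. I x (?S \<omega>) * G x (?W \<omega>)) \<partial>M)"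
  proof (rule nn_integral_cong)
    fix \<omega> assume \<omega>: "\<omega> \<in> space M"
    \<comment> \<open>The realised path: its indicator is the only one in the sum that does not
      vanish.\<close>
    define x0 where "x0 = restrict (\<lambda>j. S j \<omega>) {..<Suc (2 * m)}"
    have x0: "x0 \<in> Q"
      unfolding x0_def Q_def using measurable_space[OF Sm \<omega>] by (intro restrict_PiE_iff[THEN iffD2]) (auto simp: less_Suc_eq_le)
    have "(\<forall>j<Suc (2 * m). S j \<omega> = x j) \<longleftrightarrow> x0 = x" if "x \<in> Q" for x
    proof
      assume "\<forall>j<Suc (2 * m). S j \<omega> = x j"
      then show "x0 = x" using x0 that unfolding Q_def by (intro PiE_ext) (auto simp: x0_def)
    next
      assume "x0 = x" then show "\<forall>j<Suc (2 * m). S j \<omega> = x j" by (auto simp: x0_def)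
    qed
    then have "(\<Sum>x\<in>Q. I x (?S \<omega>) * G x (?W \<omega>)) = (\<Sum>x\<in>Q. if x0 = x then G x (?W \<omega>) else 0)"
      by (intro sum.cong refl) (simp add: I_eq)
    also have "\<dots> = G x0 (\<lambda>i. W i \<omega>)" using x0 finQ by (simp add: G_eq del: One_nat_def)
    also have "\<dots> = (\<Prod>i = 1..m. ennreal (exp (l * ((t * S (2 * i) \<omega> + W (2 * i) \<omega>) * (t * S (2 * i - 1) \<omega> + W (2 * i - 1) \<omega>)))))"
      unfolding G_def by (intro prod.cong) (auto simp: x0_def)
    also have "\<dots> = ennreal (exp (l * (\<Sum>i = 1..m. (t * S (2 * i) \<omega> + W (2 * i) \<omega>) * (t * S (2 * i - 1) \<omega> + W (2 * i - 1) \<omega>))))"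
      by (simp add: prod_ennreal exp_sum sum_distrib_left)
    finally show "ennreal (exp (l * (\<Sum>i = 1..m. (t * S (2 * i) \<omega> + W (2 * i) \<omega>) *
             (t * S (2 * i - 1) \<omega> + W (2 * i - 1) \<omega>)))) = (\<Sum>x\<in>Q. I x (?S \<omega>) * G x (?W \<omega>))" ..
  qed
  also have "\<dots> = (\<Sum>x\<in>Q. \<integral>\<^sup>+\<omega>. I x (?S \<omega>) * G x (?W \<omega>) \<partial>M)"
    by (intro nn_integral_sum borel_measurable_times_ennreal mIG)
  also have "\<dots> = (\<Sum>x\<in>Q. ennreal (\<P>(\<omega> in M. \<forall>j<Suc (2 * m). S j \<omega> = x j) *
      (\<Prod>i = 1..m. c * exp (\<nu> * (x (2 * i) * x (2 * i - 1))))))"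
    by (intro sum.cong refl) (simp only: indep_var_nn_integral_mult[OF IG] path noise ennreal_mult'[OF measure_nonneg])
  also have "\<dots> = ennreal (\<Sum>x\<in>Q. \<P>(\<omega> in M. \<forall>j<Suc (2 * m). S j \<omega> = x j) *
      (\<Prod>i = 1..m. c * exp (\<nu> * (x (2 * i) * x (2 * i - 1)))))"
    using c by (intro sum_ennreal mult_nonneg_nonneg prod_nonneg) auto
  also have "(\<Sum>x\<in>Q. \<P>(\<omega> in M. \<forall>j<Suc (2 * m). S j \<omega> = x j) *
      (\<Prod>i = 1..m. c * exp (\<nu> * (x (2 * i) * x (2 * i - 1)))))
      = ((1 - \<delta>) * (c * exp (\<nu> * 1)) + \<delta> * (c * exp (\<nu> * - 1))) ^ m"
    unfolding Q_def by (rule sign_chain_sum_pairs[OF ch, where g = "\<lambda>r. c * exp (\<nu> * r)"]) simp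
  also have "(1 - \<delta>) * (c * exp (\<nu> * 1)) + \<delta> * (c * exp (\<nu> * - 1)) = c * ((1 - \<delta>) * exp \<nu> + \<delta> * exp (- \<nu>))"
    by (simp add: algebra_simps)
  finally show ?thesis by (simp add: c_def)
qed

end

section \<open>Chernoff bound and conclusion\<close>

text \<open>Markov's inequality for \<open>exp (f \<omega>)\<close>; the Chernoff parameter is part
  of \<open>f\<close>, so either sign of it is covered.\<close>

lemma (in prob_space) exponential_tail_bound:
  fixes f :: "'a \<Rightarrow> real"
  assumes [measurable]: "f \<in> borel_measurable M"
    and mgf: "(\<integral>\<^sup>+\<omega>. ennreal (exp (f \<omega>)) \<partial>M) \<le> ennreal (exp b)"
  shows "\<P>(\<omega> in M. a \<le> f \<omega>) \<le> exp (b - a)"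
proof -
  have "{\<omega>\<in>space M. a \<le> f \<omega>} = {\<omega>\<in>space M. 1 \<le> ennreal (exp (- a)) * ennreal (exp (f \<omega>))}"
    by (simp flip: ennreal_mult exp_add)
  then have "emeasure M {\<omega>\<in>space M. a \<le> f \<omega>}
      \<le> ennreal (exp (- a)) * (\<integral>\<^sup>+\<omega>. ennreal (exp (f \<omega>)) * indicator (space M) \<omega> \<partial>M)"
    by (simp only:) (intro nn_integral_Markov_inequality; measurable)
  also have "(\<integral>\<^sup>+\<omega>. ennreal (exp (f \<omega>)) * indicator (space M) \<omega> \<partial>M) = (\<integral>\<^sup>+\<omega>. ennreal (exp (f \<omega>)) \<partial>M)"
    by (intro nn_integral_cong) simp
  also have "ennreal (exp (- a)) * \<dots> \<le> ennreal (exp (- a)) * ennreal (exp b)"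
    using mgf by (rule mult_left_mono) simp
  also have "\<dots> = ennreal (exp (b - a))"
    by (simp flip: ennreal_mult exp_add)
  finally show ?thesis by (simp add: emeasure_eq_measure)
qed

theorem corollary5:
  fixes M :: "'a measure"
    and n :: nat
    and \<delta> \<rho> :: real
    and \<theta>_star \<theta>_sharp :: "real ^ 'd"
    and S W U :: "nat \<Rightarrow> 'a \<Rightarrow> real"
  assumes "prob_space M"
    and "even n"
    and "CARD('d) \<le> n"
    and "\<delta> \<in> {0..1}"
    and "\<rho> = 1 - 2 * \<delta>"
    and "0 < norm \<theta>_star" and "norm \<theta>_star \<le> 1"
    and "\<theta>_sharp = \<theta>_star \<or> \<theta>_sharp = - \<theta>_star"
    and "sign_chain M n \<delta> S"
    and "\<And>i. i \<in> {1..n} \<Longrightarrow> distributed M lborel (W i) std_normal_density"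
    and "prob_space.indep_vars M (\<lambda>_. borel) W {1..n}"
    and "prob_space.indep_var M
           (Pi\<^sub>M {0..n} (\<lambda>_. count_space {-1, 1})) (\<lambda>\<omega>. \<lambda>i\<in>{0..n}. S i \<omega>)
           (Pi\<^sub>M {1..n} (\<lambda>_. borel)) (\<lambda>\<omega>. \<lambda>i\<in>{1..n}. W i \<omega>)"
    and "\<And>i \<omega>. i \<in> {1..n} \<Longrightarrow> \<omega> \<in> space M \<Longrightarrow> U i \<omega> = norm \<theta>_star * S i \<omega> + W i \<omega>"
  shows "\<P>(\<omega> in M.
            \<bar>delta_hat n \<theta>_sharp U \<omega> - \<delta>\<bar> = 1 / 2 * \<bar>rho_hat n \<theta>_sharp U \<omega> - \<rho>\<bar> \<and>
            1 / 2 * \<bar>rho_hat n \<theta>_sharp U \<omega> - \<rho>\<bar>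
              \<le> 18 * ln (real n) / (norm \<theta>_star)\<^sup>2 * sqrt (1 / real n))
         \<ge> 1 - 8 / real n"
proof -
  interpret prob_space M by fact
  define t where "t = norm \<theta>_star"
  have t: "0 < t" "t \<le> 1" using assms(6,7) by (simp_all add: t_def)
  have norm_sharp: "norm \<theta>_sharp = t" using assms(8) by (auto simp: t_def)
  obtain m where n: "n = 2 * m" using \<open>even n\<close> by blast
  \<comment> \<open>A dimension is at least 1, which excludes \<open>n = 0\<close>.\<close>
  have "0 < CARD('d)" by simp
  with assms(3) have "0 < n" by linarith
  then have m: "0 < m" by (simp add: n)
  define T where "T \<omega> = (\<Sum>i = 1..m. (t * S (2 * i) \<omega> + W (2 * i) \<omega>) * (t * S (2 * i - 1) \<omega> + W (2 * i - 1) \<omega>))" for \<omega>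
  \<comment> \<open>The mean of \<open>T\<close> is \<open>real m * (\<rho> * t\<^sup>2)\<close>, so
    \<open>D\<close> is the centred sum.\<close>
  define D where "D \<omega> = T \<omega> - real m * (\<rho> * t\<^sup>2)" for \<omega>
  \<comment> \<open>This choice makes the quadratic cost \<open>m * 5 * h\<^sup>2\<close> equal to
    5/8, and the threshold \<open>9 * ln n\<close> for \<open>h * \<bar>D \<omega>\<bar>\<close> is
    exactly the claimed deviation.\<close>
  define h where "h = 1 / (2 * sqrt (real n))"
  have n1: "1 \<le> real n" using \<open>0 < n\<close> by linarith
  have h: "0 < h" "h \<le> 1 / 2" "h\<^sup>2 = 1 / (4 * real n)"
    using n1 by (simp_all add: h_def power_divide power_mult_distrib)
  have mS: "S j \<in> borel_measurable M" if "j \<le> n" for j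
    using assms(9) that unfolding sign_chain_def markov_chain_def
    by (intro measurable_compose[OF _ borel_measurable_count_space, of "S j" M "{-1, 1}" "\<lambda>x. x"]) auto
  have mW: "W j \<in> borel_measurable M" if "j \<in> {1..n}" for j
    using distributed_measurable[OF assms(10)[OF that]] by simp
  have [measurable]: "T \<in> borel_measurable M"
    unfolding T_def
  proof (intro borel_measurable_sum)
    fix i assume "i \<in> {1..m}"
    then have [measurable]: "S (2 * i) \<in> borel_measurable M" "S (2 * i - 1) \<in> borel_measurable M"
        "W (2 * i) \<in> borel_measurable M" "W (2 * i - 1) \<in> borel_measurable M"
      by (auto simp: n intro!: mS mW)
    show "(\<lambda>\<omega>. (t * S (2 * i) \<omega> + W (2 * i) \<omega>) * (t * S (2 * i - 1) \<omega> + W (2 * i - 1) \<omega>)) \<in> borel_measurable M"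
      by measurable
  qed
  have [measurable]: "D \<in> borel_measurable M" unfolding D_def by measurable
  have rho_hat: "rho_hat n \<theta>_sharp U \<omega> - \<rho> = D \<omega> / (real m * t\<^sup>2)" if "\<omega> \<in> space M" for \<omega>
  proof -
    have "(\<Sum>i = 1..n div 2. U (2 * i) \<omega> * U (2 * i - 1) \<omega>) = T \<omega>"
      unfolding T_def
    proof (intro sum.cong)
      fix i assume "i \<in> {1..m}"
      then have "2 * i \<in> {1..n}" "2 * i - 1 \<in> {1..n}" by (auto simp: n)
      then show "U (2 * i) \<omega> * U (2 * i - 1) \<omega>
          = (t * S (2 * i) \<omega> + W (2 * i) \<omega>) * (t * S (2 * i - 1) \<omega> + W (2 * i - 1) \<omega>)"
        using that by (simp only: assms(13) t_def)
    qed (simp add: n)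
    then show ?thesis
      using m t unfolding rho_hat_def norm_sharp D_def by (simp add: n field_simps)
  qed

  \<comment> \<open>Only \<open>\<bar>l\<bar> = h\<close> is fixed, so both tails follow from one
    argument.\<close>
  have tail: "\<P>(\<omega> in M. 9 * ln n \<le> l * D \<omega>) \<le> exp (1 - ln n)" if l: "\<bar>l\<bar> = h" for l
  proof -
    have l2: "\<bar>l\<bar> \<le> 1 / 2" "l\<^sup>2 = 1 / (4 * real n)" using h(2) l by simp (metis h(3) l power2_abs)
    have "(\<integral>\<^sup>+\<omega>. ennreal (exp (l * T \<omega>)) \<partial>M) = ennreal ((exp (l\<^sup>2 * t\<^sup>2 / (1 - l\<^sup>2)) / sqrt (1 - l\<^sup>2) *
        ((1 - \<delta>) * exp (l * t\<^sup>2 / (1 - l\<^sup>2)) + \<delta> * exp (- (l * t\<^sup>2 / (1 - l\<^sup>2))))) ^ m)"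
      unfolding T_def using assms(4,9-12) l2 unfolding n by (intro nn_integral_exp_noisy_sign_chain) auto
    also have "\<dots> \<le> ennreal (exp (l * t\<^sup>2 * \<rho> + 5 * l\<^sup>2) ^ m)"
    proof (intro ennreal_leI power_mono)
      show "exp (l\<^sup>2 * t\<^sup>2 / (1 - l\<^sup>2)) / sqrt (1 - l\<^sup>2) *
          ((1 - \<delta>) * exp (l * t\<^sup>2 / (1 - l\<^sup>2)) + \<delta> * exp (- (l * t\<^sup>2 / (1 - l\<^sup>2)))) \<le> exp (l * t\<^sup>2 * \<rho> + 5 * l\<^sup>2)"
        unfolding assms(5) using l2 t assms(4) by (intro noisy_sign_pair_mgf_bound) auto
      have "l\<^sup>2 \<le> 1" using l2 n1 by simp
      then show "0 \<le> exp (l\<^sup>2 * t\<^sup>2 / (1 - l\<^sup>2)) / sqrt (1 - l\<^sup>2) *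
          ((1 - \<delta>) * exp (l * t\<^sup>2 / (1 - l\<^sup>2)) + \<delta> * exp (- (l * t\<^sup>2 / (1 - l\<^sup>2))))"
        using assms(4) by (intro mult_nonneg_nonneg add_nonneg_nonneg divide_nonneg_nonneg) auto
    qed
    also have "exp (l * t\<^sup>2 * \<rho> + 5 * l\<^sup>2) ^ m = exp (real m * (l * t\<^sup>2 * \<rho> + 5 * l\<^sup>2))"
      by (rule exp_of_nat_mult[symmetric])
    also have "real m * (l * t\<^sup>2 * \<rho> + 5 * l\<^sup>2) = 5 / 8 + l * (real m * (\<rho> * t\<^sup>2))"
      using m unfolding l2(2) n by (simp add: field_simps)
    finally have "\<P>(\<omega> in M. 9 * ln n + l * (real m * (\<rho> * t\<^sup>2)) \<le> l * T \<omega>)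
        \<le> exp (5 / 8 + l * (real m * (\<rho> * t\<^sup>2)) - (9 * ln n + l * (real m * (\<rho> * t\<^sup>2))))"
      by (intro exponential_tail_bound) measurable
    \<comment> \<open>The exponent at hand is 5/8 - 9 ln n; a bound of order 1/n already
      suffices.\<close>
    also have "\<dots> \<le> exp (1 - ln n)" using n1 by simp
    finally show ?thesis by (simp add: D_def right_diff_distrib le_diff_eq)
  qed

  let ?good = "{\<omega>\<in>space M. \<bar>delta_hat n \<theta>_sharp U \<omega> - \<delta>\<bar> = 1 / 2 * \<bar>rho_hat n \<theta>_sharp U \<omega> - \<rho>\<bar> \<and>
            1 / 2 * \<bar>rho_hat n \<theta>_sharp U \<omega> - \<rho>\<bar>
              \<le> 18 * ln (real n) / (norm \<theta>_star)\<^sup>2 * sqrt (1 / real n)}"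
  let ?bad = "\<lambda>l. {\<omega>\<in>space M. 9 * ln n \<le> l * D \<omega>}"
  \<comment> \<open>The equality of the two errors holds pointwise, and both sides of the inequality
    share the positive factor \<open>2 / (r * t\<^sup>2)\<close> with
    \<open>r = sqrt (real n)\<close>.\<close>
  have good: "?good = {\<omega>\<in>space M. h * \<bar>D \<omega>\<bar> \<le> 9 * ln n}"
  proof (intro Collect_cong conj_cong refl)
    fix \<omega> assume \<omega>: "\<omega> \<in> space M"
    have "\<bar>delta_hat n \<theta>_sharp U \<omega> - \<delta>\<bar> = 1 / 2 * \<bar>rho_hat n \<theta>_sharp U \<omega> - \<rho>\<bar>"
      unfolding delta_hat_def assms(5) by (simp add: abs_if field_simps)
    moreover have "1 / 2 * \<bar>rho_hat n \<theta>_sharp U \<omega> - \<rho>\<bar> \<le> 18 * ln (real n) / (norm \<theta>_star)\<^sup>2 * sqrt (1 / real n)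
        \<longleftrightarrow> h * \<bar>D \<omega>\<bar> \<le> 9 * ln n"
    proof -
      define r where "r = sqrt (real n)"
      have r: "0 < r" "real m = r\<^sup>2 / 2" using n1 by (simp_all add: r_def n)
      have "1 / 2 * \<bar>rho_hat n \<theta>_sharp U \<omega> - \<rho>\<bar> = 2 / (r * t\<^sup>2) * (h * \<bar>D \<omega>\<bar>)"
        unfolding rho_hat[OF \<omega>] h_def r_def[symmetric] r(2) using r(1) t
        by (simp add: abs_mult field_simps power2_eq_square)
      moreover have "18 * ln (real n) / (norm \<theta>_star)\<^sup>2 * sqrt (1 / real n) = 2 / (r * t\<^sup>2) * (9 * ln n)"
        by (simp add: t_def r_def real_sqrt_divide)
      moreover have "0 < 2 / (r * t\<^sup>2)" using r t by simp
      ultimately show ?thesis by (simp only: mult_le_cancel_left_pos)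
    qed
    ultimately show "(\<bar>delta_hat n \<theta>_sharp U \<omega> - \<delta>\<bar> = 1 / 2 * \<bar>rho_hat n \<theta>_sharp U \<omega> - \<rho>\<bar> \<and>
            1 / 2 * \<bar>rho_hat n \<theta>_sharp U \<omega> - \<rho>\<bar>
              \<le> 18 * ln (real n) / (norm \<theta>_star)\<^sup>2 * sqrt (1 / real n)) = (h * \<bar>D \<omega>\<bar> \<le> 9 * ln n)"
      by simp
  qed
  have "space M - ?good \<subseteq> ?bad h \<union> ?bad (- h)"
    unfolding good using h(1) by (auto simp: abs_if split: if_splits)
  then have "prob (space M - ?good) \<le> prob (?bad h \<union> ?bad (- h))"
    by (intro finite_measure_mono) measurable
  also have "\<dots> \<le> prob (?bad h) + prob (?bad (- h))"
    by (intro measure_Un_le) measurable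
  also have "\<dots> \<le> 2 * exp (1 - ln n)"
    using tail[of h] tail[of "- h"] h(1) by simp
  also have "\<dots> = 2 * exp 1 / n" using n1 by (simp add: exp_diff)
  \<comment> \<open>From e \<le> 3 the two tails together give at most 6/n.\<close>
  also have "\<dots> \<le> 8 / n" using exp_le n1 by (intro divide_right_mono) auto
  finally have "prob (space M - ?good) \<le> 8 / n" .
  moreover have "prob (space M - ?good) = 1 - prob ?good"
    unfolding good by (rule prob_compl) measurable
  ultimately show ?thesis by linarith
qed

end
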